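(* Let $n\geq 1$. For $j=1$, \[|\{\pi\in\mathrm{PPF}_{n+1}:\pi_1=j\}|=|\mathrm{PF}_{n}|=(n+1)^{n-1}.\] For $j=2,3,\ldots, n$, \[|\{\pi\in\mathrm{PPF}_{n+1}:\pi_1=j\}|=\sum_{k=1}^{n-1}\frac{n}{k+1}f_{n}(j,k).\]
   Context: A (classical) parking function of length $n$ is a sequence $\pi=(\pi_1,\dots,\pi_n)$ of positive integers whose increasing rearrangement $\lambda$ satisfies $\lambda_i\le i$; $\mathrm{PF}_n$ denotes the set of such. A parking function of length $n+1$ is prime if removing any instance of 1 yields a parking function of length $n$; $\mathrm{PPF}_{n+1}$ denotes this set. For a tuple $\alpha$, $N_1(\alpha)$ is the number of ones in $\alpha$, and $f_n(j,k)=|\{\pi\in\mathrm{PF}_n:\pi_1=j,\ N_1(\pi)=k\}|$. *)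

theory Defs
  imports Complex_Main
begin

text \<open>Sequences are lists, so the entry written \<open>\<pi>\<^sub>i\<close> on paper is \<open>\<pi> ! (i - 1)\<close>,
  and the condition \<open>\<lambda>\<^sub>i \<le> i\<close> for \<open>1 \<le> i \<le> n\<close> becomes \<open>sort \<pi> ! i \<le> i + 1\<close> for \<open>i < n\<close>.\<close>

definition PF :: "nat \<Rightarrow> nat list set" where
  "PF n = {\<pi>. length \<pi> = n \<and> (\<forall>x\<in>set \<pi>. 1 \<le> x) \<and> (\<forall>i<n. sort \<pi> ! i \<le> i + 1)}"

definition remove_nth :: "nat \<Rightarrow> 'a list \<Rightarrow> 'a list" where
  "remove_nth i xs = take i xs @ drop (Suc i) xs"

text \<open>The index is the length of the sequences. Only positive lengths are meant:
  at length \<open>0\<close> the condition is vacuous.\<close>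

definition PPF :: "nat \<Rightarrow> nat list set" where
  "PPF m = {\<pi> \<in> PF m. \<forall>i<m. \<pi> ! i = 1 \<longrightarrow> remove_nth i \<pi> \<in> PF (m - 1)}"

definition N1 :: "nat list \<Rightarrow> nat" where
  "N1 \<alpha> = count_list \<alpha> 1"

definition fPF :: "nat \<Rightarrow> nat \<Rightarrow> nat \<Rightarrow> nat" where
  "fPF n j k = card {\<pi> \<in> PF n. \<pi> ! 0 = j \<and> N1 \<pi> = k}"

end

theory Submission imports Defs begin

text \<open>
  A list is a parking function iff for every \<open>i\<close> at least \<open>i\<close> of its entries are at most \<open>i\<close>, so
  primality can be tested by removing any single one. A prime parking function starting with \<open>1\<close> is
  therefore \<open>1 # \<sigma>\<close> for an arbitrary \<open>\<sigma> \<in> PF n\<close>. For \<open>j \<noteq> 1\<close>, double counting the prime parking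
  functions with \<open>k + 1\<close> ones together with a marked one gives \<open>(k + 1) g = n f\<^sub>n(j, k)\<close>, where \<open>g\<close> is
  their number: the marked one can be inserted into any of the \<open>n\<close> positions after the first entry.
  For \<open>|PF n| = (n + 1)\<^sup>n\<^sup>-\<^sup>1\<close> (Pollak), every word of length \<open>n\<close> over the integers modulo \<open>n + 1\<close> is
  a translate, by a unique amount, of a unique parking function: the amount is the first position
  minimising \<open>#{entries < i} - i\<close>.
\<close>

section \<open>Parking functions by counting small entries\<close>

text \<open>In a sorted list the entries \<open>\<le> v\<close> form an initial segment, so their
  number is the index of the first larger entry.\<close>

lemma sorted_nth_le_iff:
  fixes xs :: "'a::linorder list"
  assumes "sorted xs" "i < length xs"
  shows "xs ! i \<le> v \<longleftrightarrow> i < length (filter (\<lambda>x. x \<le> v) xs)"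
  using assms
proof (induction xs arbitrary: i)
  case Nil
  then show ?case by simp
next
  case (Cons a xs)
  show ?case
  proof (cases "a \<le> v")
    case True
    with Cons show ?thesis by (cases i) auto
  next
    case False
    with Cons.prems(1) have "\<forall>x\<in>set (a # xs). \<not> x \<le> v" by auto
    moreover from this have "\<not> (a # xs) ! i \<le> v" using Cons.prems(2) nth_mem by blast
    ultimately show ?thesis by (auto simp: filter_empty_conv)
  qed
qed

text \<open>Counts do not depend on the order of the entries, so the sorting disappears. In this
  form, deleting, inserting and translating entries is easy to follow.\<close>

lemma PF_iff:
  "\<pi> \<in> PF n \<longleftrightarrow> length \<pi> = n \<and> (\<forall>x\<in>set \<pi>. 1 \<le> x) \<and>
     (\<forall>i\<in>{1..n}. i \<le> length (filter (\<lambda>x. x \<le> i) \<pi>))"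
proof -
  have "(\<forall>i<n. sort \<pi> ! i \<le> i + 1) \<longleftrightarrow> (\<forall>i\<in>{1..n}. i \<le> length (filter (\<lambda>x. x \<le> i) \<pi>))"
    if "length \<pi> = n"
  proof -
    have "(sort \<pi> ! i \<le> i + 1) = (i + 1 \<le> length (filter (\<lambda>x. x \<le> i + 1) \<pi>))" if "i < n" for i
      using that \<open>length \<pi> = n\<close> by (simp add: sorted_nth_le_iff filter_sort Suc_le_eq)
    then have "(\<forall>i<n. sort \<pi> ! i \<le> i + 1) \<longleftrightarrow>
        (\<forall>i<n. i + 1 \<le> length (filter (\<lambda>x. x \<le> i + 1) \<pi>))"
      by blast
    also have "\<dots> \<longleftrightarrow> (\<forall>i\<in>Suc ` {..<n}. i \<le> length (filter (\<lambda>x. x \<le> i) \<pi>))"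
      by auto
    also have "Suc ` {..<n} = {1..n}"
      by (metis One_nat_def atLeast0LessThan image_Suc_atLeastLessThan atLeastLessThanSuc_atLeastAtMost)
    finally show ?thesis .
  qed
  then show ?thesis unfolding PF_def by blast
qed

lemma PF_entry_le:
  assumes "\<pi> \<in> PF n" "x \<in> set \<pi>"
  shows "1 \<le> x" "x \<le> n"
proof -
  show "1 \<le> x" using assms by (auto simp: PF_iff)
  have "n \<noteq> 0" using assms by (auto simp: PF_iff)
  \<comment> \<open>The condition at \<open>i = n\<close> already accounts for all \<open>n\<close>
    entries, so none can exceed \<open>n\<close>.\<close>
  then have "n \<le> length (filter (\<lambda>x. x \<le> n) \<pi>)" using assms by (auto simp: PF_iff)
  then have "\<not> length (filter (\<lambda>x. x \<le> n) \<pi>) < length \<pi>" using assms by (simp add: PF_iff)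
  then show "x \<le> n" using length_filter_less[OF assms(2), of "\<lambda>x. x \<le> n"] by blast
qed

lemma finite_PF: "finite (PF n)"
proof (rule finite_subset)
  show "PF n \<subseteq> {xs. set xs \<subseteq> {..n} \<and> length xs = n}"
  proof (intro subsetI CollectI conjI)
    fix \<pi> x assume "\<pi> \<in> PF n" "x \<in> set \<pi>"
    then show "x \<in> {..n}" using PF_entry_le(2) by simp
  qed (simp add: PF_iff)
qed (simp add: finite_lists_length_eq)

lemma PF_count_one:
  assumes "\<pi> \<in> PF n" "n \<ge> 1"
  shows "count_list \<pi> 1 \<ge> 1"
proof -
  have "filter (\<lambda>x. x \<le> 1) \<pi> = filter ((=) 1) \<pi>"
    by (rule filter_cong) (use PF_entry_le[OF assms(1)] in force)+
  moreover have "1 \<le> length (filter (\<lambda>x. x \<le> 1) \<pi>)" using assms by (auto simp: PF_iff)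
  ultimately show ?thesis by (simp add: count_list_eq_length_filter)
qed

section \<open>Prime parking functions\<close>

lemma length_filter_remove_nth:
  assumes "i < length xs"
  shows "length (filter P xs) = length (filter P (remove_nth i xs)) + (if P (xs ! i) then 1 else 0)"
  by (subst id_take_nth_drop[OF assms]) (simp add: remove_nth_def)

lemma remove_nth_insert:
  assumes "i \<le> length xs"
  shows "remove_nth i (take i xs @ x # drop i xs) = xs"
  using assms by (simp add: remove_nth_def min_def)

lemma insert_remove_nth:
  assumes "i < length xs"
  shows "take i (remove_nth i xs) @ xs ! i # drop i (remove_nth i xs) = xs"
  using assms by (simp add: remove_nth_def min_def id_take_nth_drop[symmetric])

lemma length_remove_nth: "i < length xs \<Longrightarrow> length (remove_nth i xs) = length xs - 1"
  by (simp add: remove_nth_def)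

lemma set_insert_remove_nth: "i < length xs \<Longrightarrow> set xs = insert (xs ! i) (set (remove_nth i xs))"
  by (metis insert_remove_nth Un_insert_right append_take_drop_id list.simps(15) set_append)

text \<open>Removing a one lowers every count of entries \<open>\<le> l\<close> with
  \<open>l \<ge> 1\<close> by exactly one, wherever that one stands. The outcome therefore does not
  depend on the choice of \<open>i\<close>.\<close>

lemma PPF_iff_remove_nth:
  assumes "length \<pi> = Suc n" "i < Suc n" "\<pi> ! i = 1"
  shows "\<pi> \<in> PPF (Suc n) \<longleftrightarrow> remove_nth i \<pi> \<in> PF n"
proof
  assume "\<pi> \<in> PPF (Suc n)"
  then show "remove_nth i \<pi> \<in> PF n" using assms by (auto simp: PPF_def)
next
  assume r: "remove_nth i \<pi> \<in> PF n"
  have pos: "\<forall>x\<in>set \<pi>. 1 \<le> x"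
    using r assms set_insert_remove_nth[of i \<pi>] by (auto simp: PF_iff)
  \<comment> \<open>This bound no longer mentions \<open>i\<close>, so it serves any other one at
    \<open>i'\<close> and also gives the parking condition for \<pi> up to \<open>n\<close>.\<close>
  have cnt: "Suc l \<le> length (filter (\<lambda>x. x \<le> l) \<pi>)" if "l \<in> {1..n}" for l
    using r that assms length_filter_remove_nth[of i \<pi> "\<lambda>x. x \<le> l"] by (auto simp: PF_iff)
  have "remove_nth i' \<pi> \<in> PF n" if "i' < Suc n" "\<pi> ! i' = 1" for i'
  proof -
    have "l \<le> length (filter (\<lambda>x. x \<le> l) (remove_nth i' \<pi>))" if "l \<in> {1..n}" for l
      using cnt[OF that] \<open>i' < Suc n\<close> assms(1) length_filter_remove_nth[of i' \<pi> "\<lambda>x. x \<le> l"]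
      by (simp split: if_splits)
    moreover have "\<forall>x\<in>set (remove_nth i' \<pi>). 1 \<le> x"
      using pos that(1) assms(1) set_insert_remove_nth[of i' \<pi>] by simp
    ultimately show ?thesis using that(1) assms(1) by (simp add: PF_iff length_remove_nth)
  qed
  moreover have "\<pi> \<in> PF (Suc n)"
  proof -
    have "l \<le> length (filter (\<lambda>x. x \<le> l) \<pi>)" if "l \<in> {1..Suc n}" for l
    proof (cases "l = Suc n")
      case True
      have "x \<le> Suc n" if "x \<in> set \<pi>" for x
        using that assms set_insert_remove_nth[of i \<pi>] PF_entry_le(2)[OF r, of x] by auto
      then have "filter (\<lambda>x. x \<le> Suc n) \<pi> = \<pi>" by simp
      then show ?thesis using True assms(1) by simp
    next
      case False
      then show ?thesis using cnt[of l] that by auto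
    qed
    then show ?thesis using pos assms(1) by (auto simp: PF_iff)
  qed
  ultimately show "\<pi> \<in> PPF (Suc n)" by (simp add: PPF_def)
qed

lemma finite_PPF: "finite (PPF n)"
  by (rule finite_subset[OF _ finite_PF[of n]]) (auto simp: PPF_def)

lemma PPF_length: "\<pi> \<in> PPF n \<Longrightarrow> length \<pi> = n"
  by (simp add: PPF_def PF_def)

section \<open>Prime parking functions with a given first entry\<close>

lemma card_PPF_hd_one: "card {\<pi> \<in> PPF (Suc n). \<pi> ! 0 = 1} = card (PF n)"
proof -
  have "{\<pi> \<in> PPF (Suc n). \<pi> ! 0 = 1} = (#) 1 ` PF n"
  proof (intro set_eqI)
    fix \<pi> :: "nat list"
    show "\<pi> \<in> {\<pi> \<in> PPF (Suc n). \<pi> ! 0 = 1} \<longleftrightarrow> \<pi> \<in> (#) 1 ` PF n"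
    proof (cases \<pi>)
      case Nil
      then show ?thesis by (auto dest: PPF_length)
    next
      case (Cons a \<sigma>)
      have "1 # \<sigma> \<in> PPF (Suc n) \<longleftrightarrow> \<sigma> \<in> PF n"
        using PPF_iff_remove_nth[of "1 # \<sigma>" n 0] PPF_length[of "1 # \<sigma>" "Suc n"]
        by (auto simp: remove_nth_def PF_iff)
      then show ?thesis using Cons by auto
    qed
  qed
  then show ?thesis by (simp add: card_image)
qed

lemma card_PPF_marked_one:
  assumes "n \<ge> 1" "j \<noteq> 1"
  shows "(k + 1) * card {\<pi> \<in> PPF (Suc n). \<pi> ! 0 = j \<and> N1 \<pi> = k + 1} = n * fPF n j k"
proof -
  define G where "G = {\<pi> \<in> PPF (Suc n). \<pi> ! 0 = j \<and> N1 \<pi> = k + 1}"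
  define F where "F = {\<pi> \<in> PF n. \<pi> ! 0 = j \<and> N1 \<pi> = k}"
  define I where "I \<pi> = {i. i < Suc n \<and> \<pi> ! i = (1::nat)}" for \<pi>
  \<comment> \<open>The marked one is deleted but its position is kept, which makes the map
    invertible.\<close>
  have "bij_betw (\<lambda>(\<pi>, i). (remove_nth i \<pi>, i)) (SIGMA \<pi>:G. I \<pi>) (F \<times> {1..n})"
  proof (rule bij_betw_byWitness[where f' = "\<lambda>(\<sigma>, i). (take i \<sigma> @ 1 # drop i \<sigma>, i)"])
    show "\<forall>a\<in>SIGMA \<pi>:G. I \<pi>. (\<lambda>(\<sigma>, i). (take i \<sigma> @ 1 # drop i \<sigma>, i))
        ((\<lambda>(\<pi>, i). (remove_nth i \<pi>, i)) a) = a"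
    proof -
      have "take i (remove_nth i \<pi>) @ 1 # drop i (remove_nth i \<pi>) = \<pi>"
        if "\<pi> \<in> G" "i \<in> I \<pi>" for \<pi> i
        using that insert_remove_nth[of i \<pi>] PPF_length[of \<pi> "Suc n"] by (simp add: G_def I_def)
      then show ?thesis by auto
    qed
    show "\<forall>a'\<in>F \<times> {1..n}. (\<lambda>(\<pi>, i). (remove_nth i \<pi>, i))
        ((\<lambda>(\<sigma>, i). (take i \<sigma> @ 1 # drop i \<sigma>, i)) a') = a'"
      by (auto simp: F_def PF_iff remove_nth_insert)
    show "(\<lambda>(\<pi>, i). (remove_nth i \<pi>, i)) ` (SIGMA \<pi>:G. I \<pi>) \<subseteq> F \<times> {1..n}"
    proof (rule image_subsetI)
      fix a assume "a \<in> (SIGMA \<pi>:G. I \<pi>)"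
      then obtain \<pi> i where a: "a = (\<pi>, i)" and G: "\<pi> \<in> G" and I: "i \<in> I \<pi>" by blast
      have len: "length \<pi> = Suc n" using G by (simp add: G_def PPF_length)
      have i: "i < Suc n" "\<pi> ! i = 1" using I by (auto simp: I_def)
      \<comment> \<open>The first entry is \<open>j \<noteq> 1\<close>, so it is never the marked
        one and survives the deletion; this leaves \<open>n\<close> positions.\<close>
      have "i \<noteq> 0" using G i assms by (auto simp: G_def intro: gr0I)
      moreover have "remove_nth i \<pi> \<in> PF n"
        using PPF_iff_remove_nth[OF len i] G by (simp add: G_def)
      moreover have "remove_nth i \<pi> ! 0 = j"
        using \<open>i \<noteq> 0\<close> G len by (simp add: G_def remove_nth_def nth_append)
      moreover have "N1 (remove_nth i \<pi>) = k"
        using G i len length_filter_remove_nth[of i \<pi> "(=) 1"]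
        by (simp add: G_def N1_def count_list_eq_length_filter)
      ultimately show "(\<lambda>(\<pi>, i). (remove_nth i \<pi>, i)) a \<in> F \<times> {1..n}"
        using i by (simp add: a F_def)
    qed
    show "(\<lambda>(\<sigma>, i). (take i \<sigma> @ 1 # drop i \<sigma>, i)) ` (F \<times> {1..n}) \<subseteq> (SIGMA \<pi>:G. I \<pi>)"
    proof (rule image_subsetI)
      fix b assume "b \<in> F \<times> {1..n}"
      then obtain \<sigma> i where b: "b = (\<sigma>, i)" and F: "\<sigma> \<in> F" and i: "i \<in> {1..n}" by blast
      define \<pi> where "\<pi> = take i \<sigma> @ 1 # drop i \<sigma>"
      have len\<sigma>: "length \<sigma> = n" using F by (simp add: F_def PF_iff)
      then have len: "length \<pi> = Suc n" using i by (simp add: \<pi>_def)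
      have nth: "\<pi> ! i = 1" using i len\<sigma> by (simp add: \<pi>_def nth_append)
      have rem: "remove_nth i \<pi> = \<sigma>" using i len\<sigma> by (simp add: \<pi>_def remove_nth_insert)
      have "\<pi> \<in> PPF (Suc n)"
        using PPF_iff_remove_nth[OF len _ nth] rem i F by (simp add: F_def)
      moreover have "\<pi> ! 0 = j" using F i len\<sigma> by (simp add: \<pi>_def F_def nth_append)
      moreover have "N1 \<pi> = k + 1"
        using F i len rem nth length_filter_remove_nth[of i \<pi> "(=) 1"]
        by (simp add: F_def N1_def count_list_eq_length_filter)
      ultimately have "\<pi> \<in> G" "i \<in> I \<pi>" using nth i by (simp_all add: G_def I_def)
      then show "(\<lambda>(\<sigma>, i). (take i \<sigma> @ 1 # drop i \<sigma>, i)) b \<in> (SIGMA \<pi>:G. I \<pi>)"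
        by (simp add: b \<pi>_def)
    qed
  qed
  then have "card (SIGMA \<pi>:G. I \<pi>) = card (F \<times> {1..n})"
    by (rule bij_betw_same_card)
  moreover have "card (I \<pi>) = k + 1" if "\<pi> \<in> G" for \<pi>
  proof -
    have "card (I \<pi>) = count_list \<pi> 1"
      using that PPF_length[of \<pi> "Suc n"] by (simp add: I_def G_def count_list_eq_length_filter
          length_filter_conv_card eq_commute)
    then show ?thesis using that by (simp add: G_def N1_def)
  qed
  moreover have "finite G" by (simp add: G_def finite_PPF)
  ultimately have "(k + 1) * card G = n * card F"
    by (simp add: card_SigmaI I_def card_cartesian_product mult.commute)
  then show ?thesis by (simp add: G_def F_def fPF_def)
qed

text \<open>After one 1 is removed, the remaining parking function of length
  \<open>n \<ge> 1\<close> still contains another; the first entry, not being 1, gives the upper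
  bound.\<close>

lemma PPF_N1_bounds:
  assumes "n \<ge> 1" "\<pi> \<in> PPF (Suc n)" "\<pi> ! 0 \<noteq> 1"
  shows "N1 \<pi> \<in> {2..n}"
proof -
  have len: "length \<pi> = Suc n" using assms by (simp add: PPF_length)
  have "\<pi> \<in> PF (Suc n)" using assms by (simp add: PPF_def)
  then have "count_list \<pi> 1 \<noteq> 0" using PF_count_one[of \<pi> "Suc n"] by simp
  then have "1 \<in> set \<pi>" by (simp add: count_list_0_iff)
  then obtain i where i: "i < Suc n" "\<pi> ! i = 1" using len by (metis in_set_conv_nth)
  then have "remove_nth i \<pi> \<in> PF n" using PPF_iff_remove_nth[OF len i] assms by simp
  then have "count_list (remove_nth i \<pi>) 1 \<ge> 1" using assms PF_count_one by blast
  then have "N1 \<pi> \<ge> 2"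
    using i len length_filter_remove_nth[of i \<pi> "(=) 1"]
    by (simp add: N1_def count_list_eq_length_filter)
  moreover have "N1 \<pi> \<le> n"
  proof (cases \<pi>)
    case (Cons a xs)
    then show ?thesis using assms(3) len count_le_length[of xs 1] by (simp add: N1_def)
  qed (use len in simp)
  ultimately show ?thesis by simp
qed

lemma card_PPF_hd:
  assumes "n \<ge> 1" "j \<noteq> 1"
  shows "real (card {\<pi> \<in> PPF (Suc n). \<pi> ! 0 = j}) =
    (\<Sum>k=1..n - 1. real n / real (k + 1) * real (fPF n j k))"
proof -
  define S where "S = {\<pi> \<in> PPF (Suc n). \<pi> ! 0 = j}"
  have fin: "finite S" by (simp add: S_def finite_PPF)
  have N: "(\<lambda>\<pi>. N1 \<pi> - 1) ` S \<subseteq> {1..n - 1}"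
    using PPF_N1_bounds[OF assms(1)] assms(2) by (fastforce simp: S_def)
  \<comment> \<open>Since \<open>k \<ge> 1\<close>, truncated subtraction causes no collision
    between zero ones and a single one.\<close>
  have eq: "{\<pi> \<in> S. N1 \<pi> - 1 = k} = {\<pi> \<in> PPF (Suc n). \<pi> ! 0 = j \<and> N1 \<pi> = k + 1}"
    if "k \<in> {1..n - 1}" for k
    using that by (auto simp: S_def)
  have "card S = (\<Sum>k=1..n - 1. card {\<pi> \<in> S. N1 \<pi> - 1 = k})"
    using sum.group[OF fin _ N, of "\<lambda>_. 1::nat"] by simp
  also have "\<dots> = (\<Sum>k=1..n - 1. card {\<pi> \<in> PPF (Suc n). \<pi> ! 0 = j \<and> N1 \<pi> = k + 1})"
    using eq by (intro sum.cong) auto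
  finally have "real (card S) =
      (\<Sum>k=1..n - 1. real (card {\<pi> \<in> PPF (Suc n). \<pi> ! 0 = j \<and> N1 \<pi> = k + 1}))"
    by simp
  also have "\<dots> = (\<Sum>k=1..n - 1. real n / real (k + 1) * real (fPF n j k))"
  proof (rule sum.cong)
    fix k
    have "real (k + 1) * real (card {\<pi> \<in> PPF (Suc n). \<pi> ! 0 = j \<and> N1 \<pi> = k + 1}) =
        real n * real (fPF n j k)"
      using card_PPF_marked_one[OF assms, of k] by (metis of_nat_mult)
    then show "real (card {\<pi> \<in> PPF (Suc n). \<pi> ! 0 = j \<and> N1 \<pi> = k + 1}) =
        real n / real (k + 1) * real (fPF n j k)"
      by (simp add: field_simps)
  qed simp
  finally show ?thesis by (simp add: S_def)
qed

section \<open>The number of parking functions\<close>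

text \<open>Parking functions lowered by one, viewed as words over the residues modulo
  \<open>n + 1\<close>. The letter \<open>n\<close> is allowed by the alphabet but excluded by the
  condition at \<open>i = n\<close>.\<close>

definition PF0 :: "nat \<Rightarrow> nat list set" where
  "PF0 n = {\<pi>. set \<pi> \<subseteq> {..n} \<and> length \<pi> = n \<and> (\<forall>i\<in>{1..n}. i \<le> length (filter (\<lambda>x. x < i) \<pi>))}"

lemma PF_eq_image_PF0: "PF n = map Suc ` PF0 n"
proof (intro set_eqI iffI)
  fix \<pi> assume pi: "\<pi> \<in> PF n"
  define \<sigma> where "\<sigma> = map (\<lambda>x. x - 1) \<pi>"
  have eq: "\<pi> = map Suc \<sigma>"
    unfolding \<sigma>_def map_map by (rule map_idI[symmetric]) (use PF_entry_le[OF pi] in force)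
  have "set \<sigma> \<subseteq> {..n}" using PF_entry_le[OF pi] by (force simp: \<sigma>_def)
  then have "\<sigma> \<in> PF0 n"
    using pi unfolding eq by (auto simp: PF_iff PF0_def filter_map o_def Suc_le_eq)
  then show "\<pi> \<in> map Suc ` PF0 n" using eq by blast
qed (auto simp: PF_iff PF0_def filter_map o_def Suc_le_eq)

section \<open>Translating the values, not the positions, modulo \<open>n + 1\<close>\<close>

definition rot :: "nat \<Rightarrow> nat \<Rightarrow> nat list \<Rightarrow> nat list" where
  "rot n s = map (\<lambda>x. (x + s) mod Suc n)"

lemma rot_add: "rot n s (rot n t xs) = rot n (t + s) xs"
  by (simp add: rot_def mod_simps add.assoc)

lemma rot_full:
  assumes "set xs \<subseteq> {..n}"
  shows "rot n (Suc n) xs = xs"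
  unfolding rot_def by (rule map_idI) (use assms in \<open>auto simp del: add_Suc_right\<close>)

lemma set_rot: "set (rot n s xs) \<subseteq> {..n}"
  using mod_less_divisor[of "Suc n"] by (auto simp: rot_def less_Suc_eq_le)

lemma length_rot [simp]: "length (rot n s xs) = length xs"
  by (simp add: rot_def)

definition excess :: "nat list \<Rightarrow> nat \<Rightarrow> int" where
  "excess w i = int (length (filter (\<lambda>x. x < i) w)) - int i"

text \<open>Adding \<open>Suc n - s\<close> is subtracting \<open>s\<close> modulo
  \<open>n + 1\<close>. The values sent below \<open>i\<close> form the cyclic interval of length
  \<open>i\<close> starting at \<open>s\<close>, which may wrap past \<open>n\<close>.\<close>

lemma shift_less_iff:
  fixes x s i n :: nat
  assumes "x \<le> n" "s \<le> n" "i \<le> n"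
  shows "(x + (Suc n - s)) mod Suc n < i \<longleftrightarrow>
    (if s + i \<le> Suc n then s \<le> x \<and> x < s + i else s \<le> x \<or> x < s + i - Suc n)"
proof (cases "s \<le> x")
  case True
  then have "x + (Suc n - s) = (x - s) + Suc n" using assms by simp
  then have "(x + (Suc n - s)) mod Suc n = x - s"
    using assms by (metis mod_add_self2 mod_less less_Suc_eq_le less_imp_diff_less)
  then show ?thesis using True assms by auto
next
  case False
  then have "(x + (Suc n - s)) mod Suc n = x + (Suc n - s)" using assms by simp
  then show ?thesis using False assms by auto
qed

lemma length_filter_less_diff:
  fixes a b :: nat
  assumes "a \<le> b"
  shows "length (filter (\<lambda>x. a \<le> x \<and> x < b) w) + length (filter (\<lambda>x. x < a) w) =
    length (filter (\<lambda>x. x < b) w)"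
  using assms by (induction w) auto

lemma length_filter_ge_or_less:
  fixes a b :: nat
  assumes "b \<le> a"
  shows "length (filter (\<lambda>x. a \<le> x \<or> x < b) w) + length (filter (\<lambda>x. x < a) w) =
    length w + length (filter (\<lambda>x. x < b) w)"
  using assms by (induction w) auto

text \<open>A count over a cyclic interval is a difference of two initial counts. Wrapping adds the
  contribution of a full turn, \<open>length w - Suc n\<close>, which is -1 for words of length
  \<open>n\<close>.\<close>

lemma length_filter_rot:
  assumes "set w \<subseteq> {..n}" "s \<le> n" "i \<le> n"
  shows "int (length (filter (\<lambda>x. x < i) (rot n (Suc n - s) w))) - int i =
    (if s + i \<le> Suc n then excess w (s + i) - excess w s
     else int (length w) - int (Suc n) + excess w (s + i - Suc n) - excess w s)"
proof -
  have "length (filter (\<lambda>x. x < i) (rot n (Suc n - s) w)) =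
      length (filter (\<lambda>x. (x + (Suc n - s)) mod Suc n < i) w)"
    by (simp add: rot_def filter_map o_def)
  also have "filter (\<lambda>x. (x + (Suc n - s)) mod Suc n < i) w =
      filter (\<lambda>x. if s + i \<le> Suc n then s \<le> x \<and> x < s + i else s \<le> x \<or> x < s + i - Suc n) w"
  proof (rule filter_cong[OF refl])
    fix x assume "x \<in> set w"
    then show "((x + (Suc n - s)) mod Suc n < i) =
        (if s + i \<le> Suc n then s \<le> x \<and> x < s + i else s \<le> x \<or> x < s + i - Suc n)"
      using assms by (intro shift_less_iff) auto
  qed
  finally have len: "length (filter (\<lambda>x. x < i) (rot n (Suc n - s) w)) = length (filter
      (\<lambda>x. if s + i \<le> Suc n then s \<le> x \<and> x < s + i else s \<le> x \<or> x < s + i - Suc n) w)" .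
  have "s + i - Suc n \<le> s" using assms by simp
  from len length_filter_less_diff[of s "s + i" w] length_filter_ge_or_less[OF this, of w]
  show ?thesis by (auto simp: excess_def of_nat_diff)
qed

text \<open>The right side says that \<open>s\<close> is the first minimiser of
  \<open>excess w\<close> on \<open>{..n}\<close>. Positions before \<open>s\<close> are reached
  only after a full turn, which costs 1; hence the strict inequality there.\<close>

lemma rot_in_PF0_iff:
  assumes w: "set w \<subseteq> {..n}" "length w = n" and s: "s \<le> n"
  shows "rot n (Suc n - s) w \<in> PF0 n \<longleftrightarrow>
    (\<forall>t<s. excess w s < excess w t) \<and> (\<forall>t\<in>{s..n}. excess w s \<le> excess w t)"
    (is "?L \<longleftrightarrow> ?R")
proof -
  have L: "?L \<longleftrightarrow> (\<forall>i\<in>{1..n}.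
      0 \<le> int (length (filter (\<lambda>x. x < i) (rot n (Suc n - s) w))) - int i)"
    using set_rot w by (simp add: PF0_def)
  have wrap: "excess w (Suc n) = excess w 0 - 1"
  proof -
    have "filter (\<lambda>x. x < Suc n) w = w" using w by (auto simp: filter_id_conv)
    then show ?thesis using w by (simp add: excess_def)
  qed
  show ?thesis
  proof
    assume ?L
    then have *: "0 \<le> int (length (filter (\<lambda>x. x < i) (rot n (Suc n - s) w))) - int i"
      if "i \<in> {1..n}" for i
      using L that by blast
    have "excess w s < excess w t" if "t < s" for t
    \<comment> \<open>Position 0 is reached as \<open>s + i = Suc n\<close>, which the counting
      formula treats as not wrapped; \<open>wrap\<close> supplies the missing -1.\<close>
    proof (cases "t = 0")
      case True
      have mem: "Suc n - s \<in> {1..n}" "Suc n - s \<le> n" using s that by auto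
      show ?thesis
        using *[OF mem(1)] length_filter_rot[OF w(1) s mem(2)] s that wrap True by simp
    next
      case False
      then have mem: "t + Suc n - s \<in> {1..n}" "t + Suc n - s \<le> n" using s that by auto
      have "s + (t + Suc n - s) = t + Suc n" using s by simp
      then show ?thesis
        using *[OF mem(1)] length_filter_rot[OF w(1) s mem(2)] that w(2) False by simp
    qed
    moreover have "excess w s \<le> excess w t" if "t \<in> {s..n}" for t
    proof (cases "t = s")
      case False
      then have mem: "t - s \<in> {1..n}" "t - s \<le> n" using that by auto
      then show ?thesis
        using *[OF mem(1)] length_filter_rot[OF w(1) s mem(2)] that by simp
    qed simp
    ultimately show ?R by blast
  next
    assume R: ?R
    have "0 \<le> int (length (filter (\<lambda>x. x < i) (rot n (Suc n - s) w))) - int i"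
      if "i \<in> {1..n}" for i
    proof -
      consider "s + i \<le> n" | "s + i = Suc n" | "s + i > Suc n" by linarith
      then show ?thesis
      proof cases
        case 1
        then show ?thesis using R length_filter_rot[OF w(1) s, of i] that by auto
      next
        case 2
        then have "excess w s < excess w 0" using R that by auto
        then show ?thesis using 2 length_filter_rot[OF w(1) s, of i] that wrap by auto
      next
        case 3
        then have "excess w s < excess w (s + i - Suc n)" using R that by auto
        then show ?thesis using 3 length_filter_rot[OF w(1) s, of i] that w(2) by auto
      qed
    qed
    then show ?L using L by blast
  qed
qed

lemma ex1_rot_in_PF0:
  assumes w: "set w \<subseteq> {..n}" "length w = n"
  shows "\<exists>!s. s \<le> n \<and> rot n (Suc n - s) w \<in> PF0 n"
proof (rule ex_ex1I)
  define m where "m = Min (excess w ` {..n})"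
  define s where "s = (LEAST s. s \<le> n \<and> excess w s = m)"
  have "m \<in> excess w ` {..n}" unfolding m_def by (rule Min_in) auto
  then have "\<exists>s. s \<le> n \<and> excess w s = m" by auto
  then have s: "s \<le> n" "excess w s = m" unfolding s_def by (metis (mono_tags, lifting) LeastI)+
  have min: "m \<le> excess w t" if "t \<le> n" for t using that by (simp add: m_def)
  have "excess w t \<noteq> m" if "t < s" for t
    using that s(1) not_less_Least[of t "\<lambda>s. s \<le> n \<and> excess w s = m"] by (simp add: s_def)
  then have "rot n (Suc n - s) w \<in> PF0 n"
    using s min by (force simp: rot_in_PF0_iff[OF w] less_le)
  with s(1) show "\<exists>s. s \<le> n \<and> rot n (Suc n - s) w \<in> PF0 n" by blast
next
  fix s t
  assume st: "s \<le> n \<and> rot n (Suc n - s) w \<in> PF0 n" "t \<le> n \<and> rot n (Suc n - t) w \<in> PF0 n"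
  then have "(\<forall>u<s. excess w s < excess w u) \<and> (\<forall>u\<in>{s..n}. excess w s \<le> excess w u)"
    "(\<forall>u<t. excess w t < excess w u) \<and> (\<forall>u\<in>{t..n}. excess w t \<le> excess w u)"
    using rot_in_PF0_iff[OF w] by blast+
  \<comment> \<open>If \<open>s < t\<close>, strictness for \<open>t\<close> gives
    \<open>excess w t < excess w s\<close>, against the minimality of \<open>s\<close>; the other
    case is symmetric.\<close>
  with st show "s = t"
    by (metis atLeastAtMost_iff leD linorder_neqE_nat order_less_imp_le)
qed

text \<open>Each of the \<open>(n + 1) ^ n\<close> words is a translate of exactly one element of
  \<open>PF0 n\<close> by exactly one amount in \<open>{..n}\<close>; cancelling the factor
  \<open>n + 1\<close> leaves the count.\<close>

lemma card_PF:
  assumes "n \<ge> 1"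
  shows "card (PF n) = (n + 1) ^ (n - 1)"
proof -
  define W where "W = {w. set w \<subseteq> {..n} \<and> length w = n}"
  have unrot: "rot n (Suc n - s) (rot n s w) = w" "rot n s (rot n (Suc n - s) w) = w"
    if "s \<le> n" "w \<in> W" for s w
    using that rot_full[of w n] by (simp_all add: rot_add W_def)
  have sub: "PF0 n \<subseteq> W" by (auto simp: PF0_def W_def)
  have rotW: "rot n s w \<in> W" if "w \<in> W" for s w using that set_rot by (simp add: W_def)
  have uniq: "\<exists>!s. s \<le> n \<and> rot n (Suc n - s) w \<in> PF0 n" if "w \<in> W" for w
    using that ex1_rot_in_PF0 by (simp add: W_def)
  have "bij_betw (\<lambda>(s, w). rot n s w) ({..n} \<times> PF0 n) W"
  proof (rule bij_betw_imageI)
    show "inj_on (\<lambda>(s, w). rot n s w) ({..n} \<times> PF0 n)"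
    proof (rule inj_onI)
      fix a b
      assume "a \<in> {..n} \<times> PF0 n" "b \<in> {..n} \<times> PF0 n"
        "(\<lambda>(s, w). rot n s w) a = (\<lambda>(s, w). rot n s w) b"
      then obtain s p t q where ab: "a = (s, p)" "b = (t, q)"
        and h: "s \<in> {..n}" "t \<in> {..n}" "p \<in> PF0 n" "q \<in> PF0 n" "rot n s p = rot n t q"
        by auto
      have p: "rot n (Suc n - s) (rot n s p) = p" using unrot h sub by blast
      have q: "rot n (Suc n - t) (rot n s p) = q" using unrot h sub by (metis atMost_iff subsetD)
      have "rot n s p \<in> W" using rotW h sub by blast
      \<comment> \<open>Undoing either translation brings the common word into \<open>PF0 n\<close>,
        so uniqueness of the amount applies.\<close>
      then have "s = t" using uniq p q h by (metis atMost_iff)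
      then show "a = b" using p q ab by simp
    qed
    show "(\<lambda>(s, w). rot n s w) ` ({..n} \<times> PF0 n) = W"
    proof (intro equalityI subsetI)
      fix w assume "w \<in> W"
      then obtain s where "s \<le> n" "rot n (Suc n - s) w \<in> PF0 n" using uniq by blast
      then show "w \<in> (\<lambda>(s, w). rot n s w) ` ({..n} \<times> PF0 n)"
        using unrot(2) \<open>w \<in> W\<close> by (intro image_eqI[of _ _ "(s, rot n (Suc n - s) w)"]) auto
    qed (use rotW sub in auto)
  qed
  then have "card ({..n} \<times> PF0 n) = card W" by (rule bij_betw_same_card)
  also have "card W = Suc n ^ n" by (simp add: W_def card_lists_length_eq)
  also have "\<dots> = Suc n * Suc n ^ (n - 1)" using assms by (metis power_eq_if not_one_le_zero)
  finally have "Suc n * card (PF0 n) = Suc n * Suc n ^ (n - 1)"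
    by (simp only: card_cartesian_product card_atMost)
  then have "card (PF0 n) = (n + 1) ^ (n - 1)"
    by (metis Suc_eq_plus1 Suc_not_Zero mult_left_cancel)
  moreover have "card (PF n) = card (PF0 n)"
    unfolding PF_eq_image_PF0 by (rule card_image) (simp add: inj_on_def inj_map_eq_map)
  ultimately show ?thesis by simp
qed

theorem theorem2p2:
  fixes n :: nat
  assumes "n \<ge> 1"
  shows "(card {\<pi> \<in> PPF (n + 1). \<pi> ! 0 = 1} = card (PF n) \<and> card (PF n) = (n + 1) ^ (n - 1)) \<and>
    (\<forall>j\<in>{2..n}. real (card {\<pi> \<in> PPF (n + 1). \<pi> ! 0 = j}) =
       (\<Sum>k=1..n - 1. real n / real (k + 1) * real (fPF n j k)))"
  using card_PPF_hd_one[of n] card_PF[OF assms] card_PPF_hd[OF assms] by simp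

end
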